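(* For any numerical prediction vectors $\{m_1(X_i),m_0(X_i)\}_{i=1}^N$, including predictions estimated from the observed data (so possibly depending on $Z$), define $$\widehat\tau(m_1,m_0)=\frac1N\sum_{i=1}^N\Big[m_1(X_i)-m_0(X_i)+\frac{Z_i}{p}\{Y_i-m_1(X_i)\}-\frac{1-Z_i}{1-p}\{Y_i-m_0(X_i)\}\Big]$$ and $g_{m_1,m_0}(X_i)=(1-p)\,m_1(X_i)+p\,m_0(X_i)$. Then $$\widehat\tau(m_1,m_0)=\widehat\tau_{\mathrm{DM}}-\Delta_Z\{(1-p)\,m_1(X)+p\,m_0(X)\}=\widehat\tau_{\mathrm{DM}}-\Delta_Z\{g_{m_1,m_0}(X)\}.$$
   Context: There are $N$ units; $Z=(Z_1,\dots,Z_N)\in\{0,1\}^N$ is a treatment assignment with exactly $N_1$ treated units ($1\le N_1\le N-1$), $N_0=N-N_1$, $p=N_1/N$. $Y_i$ is the observed real outcome of unit $i$ and $X_i$ its covariate vector. $\widehat\tau_{\mathrm{DM}}=N_1^{-1}\sum_iZ_iY_i-N_0^{-1}\sum_i(1-Z_i)Y_i$. For a vector $A=(A_1,\dots,A_N)$, $\Delta_Z(A)=N_1^{-1}\sum_iZ_iA_i-N_0^{-1}\sum_i(1-Z_i)A_i$. For a function $f$ of covariates, $f(X)$ denotes the vector $(f(X_1),\dots,f(X_N))$. *)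

theory Defs
  imports Complex_Main
begin

text \<open>
  Units are the naturals in \<open>{1..N}\<close>; vectors over the units are functions on \<open>nat\<close>, of which only
  the values on \<open>{1..N}\<close> are used. The type \<open>'x\<close> of covariate values is arbitrary.
  The natural-number subtraction \<open>N - N1\<close> is only meaningful under \<open>N1 \<le> N\<close>.
\<close>

definition assignment :: "nat \<Rightarrow> nat \<Rightarrow> (nat \<Rightarrow> real) \<Rightarrow> bool" where
  "assignment N N1 Z \<longleftrightarrow> (\<forall>i\<in>{1..N}. Z i \<in> {0, 1}) \<and> card {i\<in>{1..N}. Z i = 1} = N1"

definition treat_prop :: "nat \<Rightarrow> nat \<Rightarrow> real" where
  "treat_prop N N1 = real N1 / real N"

definition tau_DM :: "nat \<Rightarrow> nat \<Rightarrow> (nat \<Rightarrow> real) \<Rightarrow> (nat \<Rightarrow> real) \<Rightarrow> real" where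
  "tau_DM N N1 Z Y =
     (1 / real N1) * (\<Sum>i=1..N. Z i * Y i) - (1 / real (N - N1)) * (\<Sum>i=1..N. (1 - Z i) * Y i)"

definition Delta :: "nat \<Rightarrow> nat \<Rightarrow> (nat \<Rightarrow> real) \<Rightarrow> (nat \<Rightarrow> real) \<Rightarrow> real" where
  "Delta N N1 Z A =
     (1 / real N1) * (\<Sum>i=1..N. Z i * A i) - (1 / real (N - N1)) * (\<Sum>i=1..N. (1 - Z i) * A i)"

definition tau_hat ::
  "nat \<Rightarrow> nat \<Rightarrow> (nat \<Rightarrow> real) \<Rightarrow> (nat \<Rightarrow> real) \<Rightarrow> (nat \<Rightarrow> 'x) \<Rightarrow> ('x \<Rightarrow> real) \<Rightarrow> ('x \<Rightarrow> real) \<Rightarrow> real" where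
  "tau_hat N N1 Z Y X m1 m0 = (let p = treat_prop N N1 in
     (1 / real N) * (\<Sum>i=1..N. m1 (X i) - m0 (X i)
        + Z i / p * (Y i - m1 (X i)) - (1 - Z i) / (1 - p) * (Y i - m0 (X i))))"

definition g_comb :: "nat \<Rightarrow> nat \<Rightarrow> ('x \<Rightarrow> real) \<Rightarrow> ('x \<Rightarrow> real) \<Rightarrow> 'x \<Rightarrow> real" where
  "g_comb N N1 m1 m0 x = (1 - treat_prop N N1) * m1 x + treat_prop N N1 * m0 x"

end

theory Submission
  imports Defs
begin

text \<open>The identity already holds unit by unit. With \<open>g = (1 - p) * m1 + p * m0\<close>,
  one has \<open>g = m1 - p * (m1 - m0) = m0 + (1 - p) * (m1 - m0)\<close>, so replacing both
  predictions by \<open>g\<close> in the weighted residuals absorbs exactly the term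
  \<open>m1 - m0\<close> (\<open>augmented_term_eq\<close>). Summing gives \<open>Delta\<close> of
  \<open>Y - g\<close>, which splits by linearity (\<open>tau_DM_diff_Delta\<close>). All this is
  algebra at a fixed \<open>Z\<close>, so predictions may depend on \<open>Z\<close>.\<close>

lemma augmented_term_eq:
  fixes a b z y u v :: real
  assumes "a > 0" "b > 0"
  defines "p \<equiv> a / (a + b)"
  shows "(1 / (a + b)) * (u - v + z / p * (y - u) - (1 - z) / (1 - p) * (y - v))
    = (1 / a) * (z * (y - ((1 - p) * u + p * v))) - (1 / b) * ((1 - z) * (y - ((1 - p) * u + p * v)))"
proof -
  have p: "1 - p = b / (a + b)"
    using assms by (simp add: field_simps)
  have "a + b \<noteq> 0" "a \<noteq> 0" "b \<noteq> 0"
    using assms by auto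
  then show ?thesis
    \<comment> \<open>Rewriting \<open>1 - p\<close> before \<open>p\<close> itself leaves only the
      denominators \<open>a\<close>, \<open>b\<close> and \<open>a + b\<close>, all known to be
      nonzero.\<close>
    unfolding p unfolding p_def by (simp add: divide_simps) algebra
qed

text \<open>\<open>tau_DM\<close> is \<open>Delta\<close> evaluated at \<open>Y\<close>, and
  \<open>Delta\<close> is linear in its last argument.\<close>

lemma tau_DM_diff_Delta:
  "tau_DM N N1 Z Y - Delta N N1 Z A = Delta N N1 Z (\<lambda>i. Y i - A i)"
  unfolding tau_DM_def Delta_def by (simp add: algebra_simps sum_subtractf sum.distrib)

theorem proposition6:
  fixes N N1 :: nat
    and Z Y :: "nat \<Rightarrow> real"
    and X :: "nat \<Rightarrow> 'x"
    and m1 m0 :: "'x \<Rightarrow> real"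
    and p :: real
  assumes "1 \<le> N1" and "N1 \<le> N - 1"
    and "assignment N N1 Z"
    and "p = treat_prop N N1"
  shows "tau_hat N N1 Z Y X m1 m0
           = tau_DM N N1 Z Y - Delta N N1 Z (\<lambda>i. (1 - p) * m1 (X i) + p * m0 (X i))
       \<and> tau_DM N N1 Z Y - Delta N N1 Z (\<lambda>i. (1 - p) * m1 (X i) + p * m0 (X i))
           = tau_DM N N1 Z Y - Delta N N1 Z (\<lambda>i. g_comb N N1 m1 m0 (X i))"
proof -
  let ?g = "\<lambda>i. (1 - p) * m1 (X i) + p * m0 (X i)"
  define a b where "a = real N1" and "b = real (N - N1)"
  \<comment> \<open>The bounds on \<open>N1\<close> force \<open>N1 < N\<close>, so the subtraction
    in \<open>b\<close> is not truncated.\<close>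
  have ab: "a > 0" "b > 0" and N: "real N = a + b"
    using assms(1,2) by (auto simp: a_def b_def)
  have p: "p = a / (a + b)"
    using assms(4) by (simp add: treat_prop_def N a_def)
  have "tau_hat N N1 Z Y X m1 m0 = (\<Sum>i=1..N. (1 / (a + b)) * (m1 (X i) - m0 (X i)
      + Z i / p * (Y i - m1 (X i)) - (1 - Z i) / (1 - p) * (Y i - m0 (X i))))"
    unfolding tau_hat_def Let_def assms(4)[symmetric] N by (rule sum_distrib_left)
  also have "\<dots> = (\<Sum>i=1..N. (1 / a) * (Z i * (Y i - ?g i)) - (1 / b) * ((1 - Z i) * (Y i - ?g i)))"
    unfolding p by (intro sum.cong refl augmented_term_eq ab)
  also have "\<dots> = Delta N N1 Z (\<lambda>i. Y i - ?g i)"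
    unfolding Delta_def a_def b_def by (simp only: sum_subtractf sum_distrib_left)
  finally show ?thesis
    by (simp add: tau_DM_diff_Delta g_comb_def assms(4))
qed

end
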